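(* Let $\mathcal{L}=(L,\wedge,\vee,\otimes,0,1)$ be an integral $\ell$-monoid, let $\alpha$ be an arbitrary fuzzy regular expression over a finite alphabet $X$, let $Y$ be an alphabet associated with $\alpha$, let $\mathcal A=(A,X\cup Y,\delta^A,a_0,\tau^A)$ be an arbitrary nondeterministic (finite) automaton recognizing the language $\|\alpha_R\|$, and let $\mathcal A^{\rm r}_\alpha=(A^{\rm r}_\alpha,X,\delta^{A^{\rm r}_\alpha},a_0,\tau^{A^{\rm r}_\alpha})$ be the reduced fuzzy automaton associated with $\mathcal A$ and $\alpha$, i.e. the fuzzy automaton with single crisp initial state $a_0$, set of states $$A^{\rm r}_\alpha=\{a_0\}\cup\{a\in A\mid (\exists b\in A)(\exists x\in X)\ \delta^A(b,x,a)=1\},$$ and, for $a,b\in A^{\rm r}_\alpha$, $x\in X$, $$\delta^{A^{\rm r}_\alpha}_x(a,b)=(R_{\mathcal A}\circ\delta^A_x)(a,b),\qquad \tau^{A^{\rm r}_\alpha}(a)=(R_{\mathcal A}\circ\tau^A)(a).$$ Then $L(\mathcal A^{\rm r}_\alpha)=\|\alpha\|$.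
   Context: **Integral $\ell$-monoid.** An algebra $(L,\wedge,\vee,\otimes,0,1)$ such that $(L,\wedge,\vee,0,1)$ is a lattice with least element $0$ and greatest element $1$ (not necessarily complete), $(L,\otimes,1)$ is a (not necessarily commutative) monoid whose unit is the greatest element $1$, $x\otimes 0=0\otimes x=0$, $x\otimes(y\vee z)=(x\otimes y)\vee(x\otimes z)$ and $(x\vee y)\otimes z=(x\otimes z)\vee(y\otimes z)$ for all $x,y,z\in L$. **Fuzzy languages.** A fuzzy language over an alphabet $Z$ is a map $f:Z^*\to L$ ($\varepsilon$ is the empty word). For $\lambda\in L$: $(\lambda\otimes f)(u)=\lambda\otimes f(u)$; $(f\vee g)(u)=f(u)\vee g(u)$; $(fg)(u)=\bigvee_{u=vw}f(v)\otimes g(w)$; $f^0$ is the characteristic function of $\{\varepsilon\}$, $f^{n+1}=f^nf$, and $f^*=\bigvee_{n\ge 0}f^n$ pointwise (this supremum exists because $\mathcal L$ is integral). **Fuzzy regular expressions** over a finite alphabet $X$ are defined inductively: $\emptyset$, $\varepsilon$ and each $x\in X$ are fuzzy regular expressions; if $\alpha,\alpha_1,\alpha_2$ are, then so are $(\lambda\alpha)$ for $\lambda\in L$, $(\alpha_1+\alpha_2)$, $(\alpha_1\alpha_2)$ and $(\alpha^* )$. The fuzzy language $\|\alpha\|:X^*\to L$ is defined by: $\|\emptyset\|=0$ identically; for $\alpha\in X\cup\{\varepsilon\}$, $\|\alpha\|(u)=1$ if $u=\alpha$ and $0$ otherwise; $\|\lambda\alpha\|=\lambda\otimes\|\alpha\|$;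 $\|\alpha_1+\alpha_2\|=\|\alpha_1\|\vee\|\alpha_2\|$; $\|\alpha_1\alpha_2\|=\|\alpha_1\|\,\|\alpha_2\|$; $\|\alpha^*\|=\|\alpha\|^*$. A regular expression is a fuzzy regular expression without scalars; its fuzzy language takes values in $\{0,1\}$. **The regular expression $\alpha_R$.** Let $K\subseteq L$ be the (finite, possibly empty) set of scalars appearing in $\alpha$. An alphabet associated with $\alpha$ is a set $Y$ with $Y\cap X=\emptyset$ together with a bijection $K\to Y$, $\lambda\mapsto\lambda'$. Then $\alpha_R$ is the regular expression over $X\cup Y$ obtained from $\alpha$ by replacing each scalar $\lambda$ by the letter $\lambda'$ (so scalar multiplication by $\lambda$ becomes concatenation with $\lambda'$ on the left). **Automata.** A fuzzy automaton with a single crisp initial state is $\mathcal B=(B,Z,\delta^B,b_0,\tau^B)$ with $B$ a finite nonempty set, $Z$ a finite alphabet, $\delta^B:B\times Z\times B\to L$, $b_0\in B$, $\tau^B:B\to L$. The map $\delta^B$ is extended to $B\times Z^*\times B$ by $\delta^B(a,\varepsilon,b)=1$ if $a=b$ and $0$ otherwise, and $\delta^B(a,ux,b)=\bigvee_{c\in B}\delta^B(a,u,c)\otimes\delta^B(c,x,b)$; write $\delta^B_u(a,b)=\delta^B(a,u,b)$. Its language is $L(\mathcal B)(u)=\bigvee_{b\in B}\delta^B(b_0,u,b)\otimes\tau^B(b)$. It is a nondeterministic automaton if $\delta^B$ (on letters) and $\tau^B$ take values in $\{0,1\}$. **The fuzzy relation $R_{\mathcal A}$.** A fuzzy relation on $A$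 is a map $A\times A\to L$, ordered pointwise; compositions are $(R\circ S)(a,b)=\bigvee_{c\in A}R(a,c)\otimes S(c,b)$ and, for $f:A\to L$, $(R\circ f)(a)=\bigvee_{b\in A}R(a,b)\otimes f(b)$; $R$ is transitive if $R(a,b)\otimes R(b,c)\le R(a,c)$ for all $a,b,c$. Define $R$ on $A$ by $R(a,a)=1$ and $R(a,b)=\bigvee_{\lambda'\in Y}\lambda\otimes\delta^A(a,\lambda',b)$ for $a\ne b$. Then $R_{\mathcal A}$ denotes the least transitive fuzzy relation on $A$ containing $R$; it equals $R^n=R\circ\cdots\circ R$ ($n$ factors), where $n=|A|$. *)

theory Defs
  imports Main
begin

section \<open>Integral lattice-ordered monoids\<close>

text \<open>The least element \<open>0\<close> is written \<open>\<bottom>\<close>; the monoid is \<open>(*)\<close> and \<open>1\<close>, and need not be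
  commutative. The lattice need not be complete.\<close>

unbundle lattice_syntax

class integral_l_monoid = bounded_lattice + monoid_mult +
  assumes one_eq_top: "1 = \<top>"
    and mult_bot_right [simp]: "x * \<bottom> = \<bottom>"
    and mult_bot_left [simp]: "\<bottom> * x = \<bottom>"
    and mult_sup_distrib_left: "x * (y \<squnion> z) = (x * y) \<squnion> (x * z)"
    and mult_sup_distrib_right: "(x \<squnion> y) * z = (x * z) \<squnion> (y * z)"

text \<open>Finite joins; the extra \<open>\<bottom>\<close> only matters for the empty index set. The function is meaningful
  for finite \<open>I\<close> only.\<close>

definition fsup :: "('i \<Rightarrow> 'l::integral_l_monoid) \<Rightarrow> 'i set \<Rightarrow> 'l" where
  "fsup f I = \<Squnion>\<^sub>f\<^sub>i\<^sub>n (insert \<bottom> (f ` I))"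

lemma fsup_le_iff: "finite I \<Longrightarrow> fsup f I \<le> y \<longleftrightarrow> (\<forall>i\<in>I. f i \<le> y)"
  by (simp add: fsup_def Sup_fin.bounded_iff)

lemma fsup_upper: "finite I \<Longrightarrow> i \<in> I \<Longrightarrow> f i \<le> fsup f I"
  using fsup_le_iff by blast

lemma fsup_least: "finite I \<Longrightarrow> (\<And>i. i \<in> I \<Longrightarrow> f i \<le> y) \<Longrightarrow> fsup f I \<le> y"
  by (simp add: fsup_le_iff)

lemma fsup_empty [simp]: "fsup f {} = \<bottom>"
  by (simp add: fsup_def)

lemma fsup_insert: "finite I \<Longrightarrow> fsup f (insert i I) = f i \<squnion> fsup f I"
  by (rule order.antisym) (auto simp: fsup_le_iff fsup_upper le_supI1 le_supI2 intro: fsup_least)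

lemma fsup_mult_right: "finite I \<Longrightarrow> fsup f I * z = fsup (\<lambda>i. f i * z) I"
  by (induction I rule: finite_induct) (simp_all add: fsup_insert mult_sup_distrib_right)

lemma fsup_mult_left: "finite I \<Longrightarrow> z * fsup f I = fsup (\<lambda>i. z * f i) I"
  by (induction I rule: finite_induct) (simp_all add: fsup_insert mult_sup_distrib_left)

lemma le_one [simp]: "x \<le> (1::'l::integral_l_monoid)"
  by (simp add: one_eq_top)

lemma mult_mono_left: "x \<le> y \<Longrightarrow> z * x \<le> z * (y::'l::integral_l_monoid)"
  by (metis mult_sup_distrib_left sup.absorb_iff2)

lemma mult_mono_right: "x \<le> y \<Longrightarrow> x * z \<le> y * (z::'l::integral_l_monoid)"
  by (metis mult_sup_distrib_right sup.absorb_iff2)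

lemma mult_le_left: "x * y \<le> (x::'l::integral_l_monoid)"
  using mult_mono_left[of y 1 x] by simp

lemma mult_le_right: "x * y \<le> (y::'l::integral_l_monoid)"
  using mult_mono_right[of x 1 y] by simp


section \<open>Fuzzy languages\<close>

text \<open>A fuzzy language over \<open>Z\<close> is a function on words of which only the values on \<open>lists Z\<close> matter.\<close>

type_synonym ('z, 'l) flang = "'z list \<Rightarrow> 'l"

definition fl_char :: "'z list \<Rightarrow> ('z, 'l::integral_l_monoid) flang" where
  "fl_char v = (\<lambda>u. if u = v then 1 else \<bottom>)"

definition fl_conc ::
    "('z, 'l::integral_l_monoid) flang \<Rightarrow> ('z, 'l) flang \<Rightarrow> ('z, 'l) flang" where
  "fl_conc f g = (\<lambda>u. fsup (\<lambda>(v, w). f v * g w) {(v, w). u = v @ w})"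

primrec fl_pow :: "('z, 'l::integral_l_monoid) flang \<Rightarrow> nat \<Rightarrow> ('z, 'l) flang" where
  "fl_pow f 0 = fl_char []"
| "fl_pow f (Suc n) = fl_conc (fl_pow f n) f"

text \<open>The least upper bound of all \<open>f\<^sup>n u\<close>; it exists although the lattice may be incomplete, see
  \<open>fl_star_lub\<close> below.\<close>

definition fl_star :: "('z, 'l::integral_l_monoid) flang \<Rightarrow> ('z, 'l) flang" where
  "fl_star f = (\<lambda>u. LEAST s. \<forall>n. fl_pow f n u \<le> s)"

lemma finite_splits: "finite {(v, w). u = v @ w}"
proof -
  have "{(v, w). u = v @ w} \<subseteq> (\<lambda>i. (take i u, drop i u)) ` {..length u}"
  proof (clarify)
    fix v w :: "'a list"
    show "(v, w) \<in> (\<lambda>i. (take i (v @ w), drop i (v @ w))) ` {..length (v @ w)}"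
      by (rule image_eqI[where x = "length v"]) auto
  qed
  then show ?thesis by (rule finite_subset) simp
qed

lemma fl_pow_le: "fl_pow f n u \<le> fsup (\<lambda>k. fl_pow f k u) {..length u}"
proof (induction n arbitrary: u)
  case 0
  show ?case by (rule fsup_upper) auto
next
  case (Suc n)
  have "fl_pow f n v * f w \<le> fsup (\<lambda>k. fl_pow f k u) {..length u}" if u: "u = v @ w" for v w
  proof (cases "w = []")
    case True
    then show ?thesis using u Suc.IH[of u] mult_le_left order_trans by fastforce
  next
    case False
    have "fl_pow f n v * f w \<le> fsup (\<lambda>k. fl_pow f k v) {..length v} * f w"
      by (rule mult_mono_right) (rule Suc.IH)
    also have "\<dots> = fsup (\<lambda>k. fl_pow f k v * f w) {..length v}"
      by (simp add: fsup_mult_right)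
    also have "\<dots> \<le> fsup (\<lambda>k. fl_pow f k u) {..length u}"
    proof (rule fsup_least)
      fix k assume k: "k \<in> {..length v}"
      have "fl_pow f k v * f w \<le> fl_pow f (Suc k) u"
        using fsup_upper[OF finite_splits[of u], of "(v, w)" "\<lambda>(v, w). fl_pow f k v * f w"] u
        by (simp add: fl_conc_def)
      also have "\<dots> \<le> fsup (\<lambda>k. fl_pow f k u) {..length u}"
      proof (rule fsup_upper)
        show "Suc k \<in> {..length u}"
          using k u False by (cases w) auto
      qed simp
      finally show "fl_pow f k v * f w \<le> fsup (\<lambda>k. fl_pow f k u) {..length u}" .
    qed simp
    finally show ?thesis .
  qed
  then show ?case
    by (auto simp: fl_conc_def fsup_le_iff[OF finite_splits])
qed

lemma fl_star_eq: "fl_star f u = fsup (\<lambda>k. fl_pow f k u) {..length u}"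
  unfolding fl_star_def
  by (rule Least_equality) (auto simp: fl_pow_le fsup_le_iff)

lemma fl_star_lub: "fl_star f u \<le> s \<longleftrightarrow> (\<forall>n. fl_pow f n u \<le> s)"
  unfolding fl_star_eq
  by (auto simp: fsup_le_iff intro: order_trans[OF fl_pow_le])


section \<open>Fuzzy regular expressions\<close>

datatype (scalars: 'l, letters: 'z) frexp =
    Empty
  | Eps
  | Letter 'z
  | Scal 'l "('l, 'z) frexp"
  | Plus "('l, 'z) frexp" "('l, 'z) frexp"
  | Conc "('l, 'z) frexp" "('l, 'z) frexp"
  | Star "('l, 'z) frexp"

primrec frexp_lang :: "('l::integral_l_monoid, 'z) frexp \<Rightarrow> ('z, 'l) flang" where
  "frexp_lang Empty = (\<lambda>u. \<bottom>)"
| "frexp_lang Eps = fl_char []"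
| "frexp_lang (Letter x) = fl_char [x]"
| "frexp_lang (Scal l \<alpha>) = (\<lambda>u. l * frexp_lang \<alpha> u)"
| "frexp_lang (Plus \<alpha> \<beta>) = (\<lambda>u. frexp_lang \<alpha> u \<squnion> frexp_lang \<beta> u)"
| "frexp_lang (Conc \<alpha> \<beta>) = fl_conc (frexp_lang \<alpha>) (frexp_lang \<beta>)"
| "frexp_lang (Star \<alpha>) = fl_star (frexp_lang \<alpha>)"

text \<open>\<open>X\<close> and \<open>Y\<close> are disjoint subsets of one type of letters; \<open>p\<close> is the bijection sending the
  scalar \<open>\<lambda>\<close> to the letter \<open>\<lambda>'\<close>.\<close>

definition associated_alphabet ::
    "'z set \<Rightarrow> ('l, 'z) frexp \<Rightarrow> 'z set \<Rightarrow> ('l \<Rightarrow> 'z) \<Rightarrow> bool" where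
  "associated_alphabet X \<alpha> Y p \<longleftrightarrow> Y \<inter> X = {} \<and> bij_betw p (scalars \<alpha>) Y"

primrec frexp_R :: "('l \<Rightarrow> 'z) \<Rightarrow> ('l, 'z) frexp \<Rightarrow> ('l, 'z) frexp" where
  "frexp_R p Empty = Empty"
| "frexp_R p Eps = Eps"
| "frexp_R p (Letter x) = Letter x"
| "frexp_R p (Scal l \<alpha>) = Conc (Letter (p l)) (frexp_R p \<alpha>)"
| "frexp_R p (Plus \<alpha> \<beta>) = Plus (frexp_R p \<alpha>) (frexp_R p \<beta>)"
| "frexp_R p (Conc \<alpha> \<beta>) = Conc (frexp_R p \<alpha>) (frexp_R p \<beta>)"
| "frexp_R p (Star \<alpha>) = Star (frexp_R p \<alpha>)"

lemma finite_scalars: "finite (scalars \<alpha>)"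
  by (induction \<alpha>) auto

lemma scalars_frexp_R: "scalars (frexp_R p \<alpha>) = {}"
  by (induction \<alpha>) auto

lemma letters_frexp_R: "letters (frexp_R p \<alpha>) = letters \<alpha> \<union> p ` scalars \<alpha>"
  by (induction \<alpha>) auto


section \<open>Fuzzy automata\<close>

record ('s, 'z, 'l) fuzzy_aut =
  states :: "'s set"
  alphabet :: "'z set"
  delta :: "'s \<Rightarrow> 'z \<Rightarrow> 's \<Rightarrow> 'l"
  init :: 's
  final :: "'s \<Rightarrow> 'l"

definition fuzzy_automaton :: "('s, 'z, 'l::integral_l_monoid) fuzzy_aut \<Rightarrow> bool" where
  "fuzzy_automaton B \<longleftrightarrow> finite (states B) \<and> finite (alphabet B) \<and> init B \<in> states B"

definition nondeterministic :: "('s, 'z, 'l::integral_l_monoid) fuzzy_aut \<Rightarrow> bool" where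
  "nondeterministic B \<longleftrightarrow> fuzzy_automaton B \<and>
     (\<forall>a\<in>states B. \<forall>x\<in>alphabet B. \<forall>b\<in>states B. delta B a x b \<in> {\<bottom>, 1}) \<and>
     (\<forall>a\<in>states B. final B a \<in> {\<bottom>, 1})"

text \<open>The extension of \<open>delta\<close> to words is by recursion on the last letter, see \<open>delta_word_snoc\<close>.\<close>

definition delta_word ::
    "('s, 'z, 'l::integral_l_monoid) fuzzy_aut \<Rightarrow> 's \<Rightarrow> 'z list \<Rightarrow> 's \<Rightarrow> 'l" where
  "delta_word B a u =
     foldl (\<lambda>g x b. fsup (\<lambda>c. g c * delta B c x b) (states B)) (\<lambda>b. if a = b then 1 else \<bottom>) u"

lemma delta_word_Nil: "delta_word B a [] b = (if a = b then 1 else \<bottom>)"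
  by (simp add: delta_word_def)

lemma delta_word_snoc:
  "delta_word B a (u @ [x]) b = fsup (\<lambda>c. delta_word B a u c * delta B c x b) (states B)"
  by (simp add: delta_word_def)

definition aut_lang :: "('s, 'z, 'l::integral_l_monoid) fuzzy_aut \<Rightarrow> ('z, 'l) flang" where
  "aut_lang B u = fsup (\<lambda>b. delta_word B (init B) u b * final B b) (states B)"


section \<open>Fuzzy relations and the reduced automaton\<close>

definition rel_comp ::
    "'s set \<Rightarrow> ('s \<Rightarrow> 's \<Rightarrow> 'l::integral_l_monoid) \<Rightarrow> ('s \<Rightarrow> 's \<Rightarrow> 'l) \<Rightarrow> 's \<Rightarrow> 's \<Rightarrow> 'l" where
  "rel_comp A R S a b = fsup (\<lambda>c. R a c * S c b) A"

definition rel_comp_set ::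
    "'s set \<Rightarrow> ('s \<Rightarrow> 's \<Rightarrow> 'l::integral_l_monoid) \<Rightarrow> ('s \<Rightarrow> 'l) \<Rightarrow> 's \<Rightarrow> 'l" where
  "rel_comp_set A R f a = fsup (\<lambda>b. R a b * f b) A"

definition transitive_on :: "'s set \<Rightarrow> ('s \<Rightarrow> 's \<Rightarrow> 'l::integral_l_monoid) \<Rightarrow> bool" where
  "transitive_on A R \<longleftrightarrow> (\<forall>a\<in>A. \<forall>b\<in>A. \<forall>c\<in>A. R a b * R b c \<le> R a c)"

text \<open>Fuzzy relations on the carrier \<open>A\<close> are represented by functions on the whole type that are
  \<open>\<bottom>\<close> outside \<open>A \<times> A\<close>, so that the pointwise order of functions is the order of relations.\<close>

definition fuzzy_rel_on :: "'s set \<Rightarrow> ('s \<Rightarrow> 's \<Rightarrow> 'l::integral_l_monoid) \<Rightarrow> bool" where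
  "fuzzy_rel_on A R \<longleftrightarrow> (\<forall>a b. a \<notin> A \<or> b \<notin> A \<longrightarrow> R a b = \<bottom>)"

definition least_transitive ::
    "'s set \<Rightarrow> ('s \<Rightarrow> 's \<Rightarrow> 'l::integral_l_monoid) \<Rightarrow> 's \<Rightarrow> 's \<Rightarrow> 'l" where
  "least_transitive A R = (LEAST T. fuzzy_rel_on A T \<and> transitive_on A T \<and> R \<le> T)"

text \<open>Here \<open>K\<close> is the set of scalars; indexing the join by \<open>\<lambda> \<in> K\<close> is the same as indexing it by
  \<open>\<lambda>' \<in> Y\<close>, as \<open>\<lambda> \<mapsto> \<lambda>'\<close> is a bijection.\<close>

definition rel_R ::
    "('s, 'z, 'l::integral_l_monoid) fuzzy_aut \<Rightarrow> 'l set \<Rightarrow> ('l \<Rightarrow> 'z) \<Rightarrow> 's \<Rightarrow> 's \<Rightarrow> 'l" where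
  "rel_R A K p a b =
     (if a \<in> states A \<and> b \<in> states A
      then if a = b then 1 else fsup (\<lambda>l. l * delta A a (p l) b) K
      else \<bottom>)"

definition rel_RA ::
    "('s, 'z, 'l::integral_l_monoid) fuzzy_aut \<Rightarrow> 'l set \<Rightarrow> ('l \<Rightarrow> 'z) \<Rightarrow> 's \<Rightarrow> 's \<Rightarrow> 'l" where
  "rel_RA A K p = least_transitive (states A) (rel_R A K p)"

definition reduced_automaton ::
    "('s, 'z, 'l::integral_l_monoid) fuzzy_aut \<Rightarrow> 'z set \<Rightarrow> ('l, 'z) frexp \<Rightarrow> ('l \<Rightarrow> 'z)
     \<Rightarrow> ('s, 'z, 'l) fuzzy_aut" where
  "reduced_automaton A X \<alpha> p =
     \<lparr> states = {init A} \<union> {a \<in> states A. \<exists>b\<in>states A. \<exists>x\<in>X. delta A b x a = 1},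
       alphabet = X,
       delta = \<lambda>a x b. rel_comp (states A) (rel_RA A (scalars \<alpha>) p) (\<lambda>c d. delta A c x d) a b,
       init = init A,
       final = \<lambda>a. rel_comp_set (states A) (rel_RA A (scalars \<alpha>) p) (final A) a \<rparr>"

text \<open>The least transitive relation in the definition of \<open>rel_RA\<close> exists: it is the join of the
  weights of all repetition-free paths.\<close>

fun path_weight :: "('s \<Rightarrow> 's \<Rightarrow> 'l::integral_l_monoid) \<Rightarrow> 's list \<Rightarrow> 'l" where
  "path_weight R (a # b # xs) = R a b * path_weight R (b # xs)"
| "path_weight R _ = 1"

lemma path_weight_suffix: "path_weight R (us @ vs) \<le> path_weight R vs"
proof (induction us)
  case (Cons a us)
  have "path_weight R (a # us @ vs) \<le> path_weight R (us @ vs)"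
    by (cases "us @ vs") (simp_all add: mult_le_right)
  with Cons show ?case by simp
qed simp

lemma path_weight_append:
  "path_weight R (xs @ b # ys) = path_weight R (xs @ [b]) * path_weight R (b # ys)"
  by (induction R xs rule: path_weight.induct) (simp_all add: mult.assoc)

lemma path_weight_distinct:
  "xs \<noteq> [] \<Longrightarrow> set xs \<subseteq> A \<Longrightarrow>
   \<exists>ys. ys \<noteq> [] \<and> set ys \<subseteq> A \<and> distinct ys \<and> hd ys = hd xs \<and> last ys = last xs \<and>
     path_weight R xs \<le> path_weight R ys"
proof (induction xs)
  case (Cons x xs)
  show ?case
  proof (cases "xs = []")
    case True
    then show ?thesis using Cons.prems by (intro exI[of _ "[x]"]) simp
  next
    case False
    then obtain ys where ys: "ys \<noteq> []" "set ys \<subseteq> A" "distinct ys" "hd ys = hd xs"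
      "last ys = last xs" "path_weight R xs \<le> path_weight R ys"
      using Cons by auto
    show ?thesis
    proof (cases "x \<in> set ys")
      case True
      then obtain us vs where uv: "ys = us @ x # vs"
        by (meson split_list)
      have "path_weight R (x # xs) \<le> path_weight R xs"
        using path_weight_suffix[of R "[x]" xs] by simp
      also have "\<dots> \<le> path_weight R ys" by fact
      also have "\<dots> \<le> path_weight R (x # vs)"
        unfolding uv by (rule path_weight_suffix)
      finally show ?thesis
        using uv ys False by (intro exI[of _ "x # vs"]) auto
    next
      case False
      have "path_weight R (x # xs) \<le> path_weight R (x # ys)"
        using ys \<open>xs \<noteq> []\<close> by (cases xs; cases ys) (auto intro: mult_mono_left)
      then show ?thesis
        using False ys \<open>xs \<noteq> []\<close> Cons.prems by (intro exI[of _ "x # ys"]) auto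
    qed
  qed
qed simp

lemma least_transitive_exists:
  fixes R :: "'s \<Rightarrow> 's \<Rightarrow> 'l::integral_l_monoid"
  assumes fin: "finite A" and R: "fuzzy_rel_on A R" and refl: "\<And>a. a \<in> A \<Longrightarrow> R a a = 1"
  shows "\<exists>T. fuzzy_rel_on A T \<and> transitive_on A T \<and> R \<le> T \<and>
     (\<forall>S. fuzzy_rel_on A S \<and> transitive_on A S \<and> R \<le> S \<longrightarrow> T \<le> S)"
proof -
  define P where
    "P a b = {xs. xs \<noteq> [] \<and> set xs \<subseteq> A \<and> distinct xs \<and> hd xs = a \<and> last xs = b}" for a b
  define T where "T a b = fsup (path_weight R) (P a b)" for a b
  have finP: "finite (P a b)" for a b
  proof (rule finite_subset)
    show "P a b \<subseteq> {xs. set xs \<subseteq> A \<and> length xs \<le> card A}"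
      using fin by (auto simp: P_def distinct_card[symmetric] intro: card_mono)
    show "finite {xs. set xs \<subseteq> A \<and> length xs \<le> card A}"
      using fin by (rule finite_lists_length_le)
  qed
  have walk: "path_weight R xs \<le> T (hd xs) (last xs)" if xs: "xs \<noteq> []" "set xs \<subseteq> A" for xs
  proof -
    obtain ys where "ys \<in> P (hd xs) (last xs)" "path_weight R xs \<le> path_weight R ys"
      using path_weight_distinct[OF xs, of R] by (auto simp: P_def)
    then show ?thesis
      unfolding T_def using fsup_upper[OF finP] order_trans by blast
  qed
  have rel: "fuzzy_rel_on A T"
    unfolding fuzzy_rel_on_def
  proof (intro allI impI)
    fix a b assume "a \<notin> A \<or> b \<notin> A"
    then have "P a b = {}" by (force simp: P_def)
    then show "T a b = \<bottom>" by (simp add: T_def)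
  qed
  have "T a b * T b c \<le> T a c" for a b c
  proof -
    have "path_weight R xs * path_weight R ys \<le> T a c"
      if P: "xs \<in> P a b" "ys \<in> P b c" for xs ys
    proof -
      obtain xs' ys' where eq: "xs = xs' @ [b]" "ys = b # ys'"
      proof -
        have "xs = butlast xs @ [b]" "ys = b # tl ys"
          using P append_butlast_last_id[of xs] list.collapse[of ys] by (auto simp: P_def)
        then show ?thesis using that[of "butlast xs" "tl ys"] by blast
      qed
      have "path_weight R (xs' @ b # ys') \<le> T (hd (xs' @ b # ys')) (last (xs' @ b # ys'))"
        using P by (intro walk) (auto simp: P_def eq)
      moreover have "hd (xs' @ b # ys') = a" "last (xs' @ b # ys') = c"
        using P by (auto simp: P_def eq hd_append)
      ultimately show ?thesis
        by (simp add: eq path_weight_append[symmetric])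
    qed
    then show ?thesis
      unfolding T_def[of a b] T_def[of b c]
      by (simp add: finP fsup_mult_right fsup_mult_left fsup_le_iff)
  qed
  then have tr: "transitive_on A T" by (simp add: transitive_on_def)
  have "R a b \<le> T a b" for a b
    using walk[of "[a, b]"] R by (cases "a \<in> A \<and> b \<in> A") (auto simp: fuzzy_rel_on_def)
  then have le: "R \<le> T" by (simp add: le_fun_def)
  have "T \<le> S" if S: "transitive_on A S" "R \<le> S" for S
  proof -
    have w: "xs \<noteq> [] \<Longrightarrow> set xs \<subseteq> A \<Longrightarrow> path_weight R xs \<le> S (hd xs) (last xs)" for xs
    proof (induction xs)
      case (Cons a xs)
      note IH = Cons.IH and prems = Cons.prems
      show ?case
      proof (cases xs)
        case Nil
        have "1 \<le> S a a"
          using S(2) refl[of a] prems by (metis le_funD list.set_intros(1) subsetD)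
        with Nil show ?thesis by simp
      next
        case (Cons b ys)
        have "path_weight R (b # ys) \<le> S b (last (b # ys))"
          using IH prems Cons by simp
        moreover have "R a b \<le> S a b"
          using S(2) by (simp add: le_fun_def)
        ultimately have "R a b * path_weight R (b # ys) \<le> S a b * S b (last (b # ys))"
          by (meson mult_mono_left mult_mono_right order_trans)
        also have "\<dots> \<le> S a (last (b # ys))"
        proof -
          have "last (b # ys) \<in> set (b # ys)" by (rule last_in_set) simp
          then show ?thesis
            using S(1)[unfolded transitive_on_def, rule_format, of a b "last (b # ys)"] prems Cons
            by auto
        qed
        finally show ?thesis using Cons by simp
      qed
    qed simp
    show ?thesis
      by (auto simp: le_fun_def T_def fsup_le_iff[OF finP]) (auto simp: P_def dest: w)
  qed
  with rel tr le show ?thesis by blast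
qed

lemma rel_RA_least:
  assumes "fuzzy_automaton A"
  shows "fuzzy_rel_on (states A) (rel_RA A K p)"
    and "transitive_on (states A) (rel_RA A K p)"
    and "rel_R A K p \<le> rel_RA A K p"
    and "fuzzy_rel_on (states A) S \<Longrightarrow> transitive_on (states A) S \<Longrightarrow> rel_R A K p \<le> S
      \<Longrightarrow> rel_RA A K p \<le> S"
proof -
  let ?Q = "\<lambda>T. fuzzy_rel_on (states A) T \<and> transitive_on (states A) T \<and> rel_R A K p \<le> T"
  obtain T where T: "?Q T" "\<And>S. ?Q S \<Longrightarrow> T \<le> S"
  proof -
    have "finite (states A)" "fuzzy_rel_on (states A) (rel_R A K p)"
      "\<And>a. a \<in> states A \<Longrightarrow> rel_R A K p a a = 1"
      using assms by (auto simp: fuzzy_automaton_def fuzzy_rel_on_def rel_R_def)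
    from least_transitive_exists[OF this] show ?thesis using that by blast
  qed
  have "rel_RA A K p = T"
    unfolding rel_RA_def least_transitive_def by (rule Least_equality) (use T in auto)
  then show "fuzzy_rel_on (states A) (rel_RA A K p)" "transitive_on (states A) (rel_RA A K p)"
    "rel_R A K p \<le> rel_RA A K p"
    "fuzzy_rel_on (states A) S \<Longrightarrow> transitive_on (states A) S \<Longrightarrow> rel_R A K p \<le> S
      \<Longrightarrow> rel_RA A K p \<le> S"
    using T by auto
qed

lemma fuzzy_automaton_reduced:
  assumes "fuzzy_automaton A" and "X \<subseteq> alphabet A"
  shows "fuzzy_automaton (reduced_automaton A X \<alpha> p)"
  using assms by (auto simp: fuzzy_automaton_def reduced_automaton_def dest: finite_subset)

end

theory Submission
  imports Defs
begin

text \<open>Give a word over \<open>X \<union> Y\<close> the product of the weights of its letters, where \<open>x \<in> X\<close> weighs \<open>1\<close>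
  and \<open>\<lambda>'\<close> weighs \<open>\<lambda>\<close>, and let its trace be the word over \<open>X\<close> left after erasing all letters of
  \<open>Y\<close>. Both \<open>\<parallel>\<alpha>\<parallel>(u)\<close> and the value of the reduced automaton at \<open>u\<close> are the join of the weights of
  the words of \<open>\<parallel>\<alpha>\<^sub>R\<parallel>\<close> with trace \<open>u\<close>. There may be infinitely many such words and the lattice need
  not be complete, so that products need not distribute over this join; what makes the inductions
  work is that the join is always attained by finitely many of the words.\<close>

section \<open>Finite joins and crisp languages\<close>

lemma fsup_cong: "(\<And>i. i \<in> I \<Longrightarrow> f i = g i) \<Longrightarrow> fsup f I = fsup g I"
  by (simp add: fsup_def cong: image_cong_simp)

text \<open>Associativity of row vector times matrix times column vector: both sides are the join of
  all \<open>f i * g i j * k j\<close>, because products distribute over finite joins. It serves to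
  regroup the factors \<open>R_A\<close> in the reduced automaton.\<close>

lemma fsup_matrix_assoc:
  assumes "finite I" and "finite J"
  shows "fsup (\<lambda>i. f i * fsup (\<lambda>j. g i j * k j) J) I = fsup (\<lambda>j. fsup (\<lambda>i. f i * g i j) I * k j) J"
proof (rule order.antisym)
  have "f i * (g i j * k j) \<le> fsup (\<lambda>j. fsup (\<lambda>i. f i * g i j) I * k j) J"
    if "i \<in> I" "j \<in> J" for i j
  proof -
    have "f i * g i j * k j \<le> fsup (\<lambda>i. f i * g i j) I * k j"
      using assms(1) that(1) by (intro mult_mono_right fsup_upper[where f = "\<lambda>i. f i * g i j"])
    also have "\<dots> \<le> fsup (\<lambda>j. fsup (\<lambda>i. f i * g i j) I * k j) J"
      using assms(2) that(2) by (rule fsup_upper)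
    finally show ?thesis by (simp add: mult.assoc)
  qed
  then show "fsup (\<lambda>i. f i * fsup (\<lambda>j. g i j * k j) J) I
      \<le> fsup (\<lambda>j. fsup (\<lambda>i. f i * g i j) I * k j) J"
    using assms by (simp add: fsup_mult_left fsup_le_iff)
  have "f i * g i j * k j \<le> fsup (\<lambda>i. f i * fsup (\<lambda>j. g i j * k j) J) I"
    if "i \<in> I" "j \<in> J" for i j
  proof -
    have "f i * (g i j * k j) \<le> f i * fsup (\<lambda>j. g i j * k j) J"
      using assms(2) that(2) by (intro mult_mono_left fsup_upper[where f = "\<lambda>j. g i j * k j"])
    also have "\<dots> \<le> fsup (\<lambda>i. f i * fsup (\<lambda>j. g i j * k j) J) I"
      using assms(1) that(1) by (rule fsup_upper)
    finally show ?thesis by (simp add: mult.assoc)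
  qed
  then show "fsup (\<lambda>j. fsup (\<lambda>i. f i * g i j) I * k j) J
      \<le> fsup (\<lambda>i. f i * fsup (\<lambda>j. g i j * k j) J) I"
    using assms by (simp add: fsup_mult_right fsup_le_iff)
qed

lemma fsup_crisp:
  assumes "finite I"
  shows "fsup (\<lambda>i. if P i then 1 else \<bottom>) I = (if \<exists>i\<in>I. P i then 1 else \<bottom>)"
  using assms by (induction I rule: finite_induct) (auto simp: fsup_insert one_eq_top)

section \<open>Crisp languages as sets of words\<close>

definition crisp :: "'z list set \<Rightarrow> ('z, 'l::integral_l_monoid) flang" where
  "crisp W = (\<lambda>w. if w \<in> W then 1 else \<bottom>)"

definition set_conc :: "'z list set \<Rightarrow> 'z list set \<Rightarrow> 'z list set" where
  "set_conc V W = {v @ w | v w. v \<in> V \<and> w \<in> W}"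

primrec set_pow :: "'z list set \<Rightarrow> nat \<Rightarrow> 'z list set" where
  "set_pow W 0 = {[]}"
| "set_pow W (Suc n) = set_conc (set_pow W n) W"

lemma fl_char_eq_crisp: "fl_char v = crisp {v}"
  by (simp add: fl_char_def crisp_def)

lemma fl_conc_crisp: "fl_conc (crisp V) (crisp W) = crisp (set_conc V W)"
proof
  fix u
  have "fl_conc (crisp V) (crisp W) u
      = fsup (\<lambda>i. if fst i \<in> V \<and> snd i \<in> W then 1 else \<bottom>) {(v, w). u = v @ w}"
    unfolding fl_conc_def by (rule fsup_cong) (auto simp: crisp_def)
  then show "fl_conc (crisp V) (crisp W) u = crisp (set_conc V W) u"
    by (auto simp: fsup_crisp finite_splits crisp_def set_conc_def)
qed

lemma fl_pow_crisp: "fl_pow (crisp W) n = crisp (set_pow W n)"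
  by (induction n) (simp_all add: fl_char_eq_crisp fl_conc_crisp)

text \<open>Two elements with the same upper bounds are equal, and the star is the least upper bound
  of all powers, so the infinite union needs no completeness.\<close>

lemma fl_star_crisp: "fl_star (crisp W) = crisp (\<Union>n. set_pow W n)"
proof
  fix u
  have "fl_star (crisp W) u \<le> s \<longleftrightarrow> crisp (\<Union>n. set_pow W n) u \<le> s" for s
    unfolding fl_star_lub fl_pow_crisp by (auto simp: crisp_def)
  then show "fl_star (crisp W) u = crisp (\<Union>n. set_pow W n) u"
    by (meson order.antisym order.refl)
qed

text \<open>The support of the language of \<open>frexp_R p \<alpha>\<close>, by recursion on
  \<alpha> itself, so that it can be compared with \<open>frexp_lang \<alpha>\<close> in one
  structural induction.\<close>

primrec frexp_words :: "('l \<Rightarrow> 'z) \<Rightarrow> ('l, 'z) frexp \<Rightarrow> 'z list set" where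
  "frexp_words p Empty = {}"
| "frexp_words p Eps = {[]}"
| "frexp_words p (Letter x) = {[x]}"
| "frexp_words p (Scal l \<alpha>) = set_conc {[p l]} (frexp_words p \<alpha>)"
| "frexp_words p (Plus \<alpha> \<beta>) = frexp_words p \<alpha> \<union> frexp_words p \<beta>"
| "frexp_words p (Conc \<alpha> \<beta>) = set_conc (frexp_words p \<alpha>) (frexp_words p \<beta>)"
| "frexp_words p (Star \<alpha>) = (\<Union>n. set_pow (frexp_words p \<alpha>) n)"

lemma frexp_lang_R: "frexp_lang (frexp_R p \<alpha>) = crisp (frexp_words p \<alpha>)"
proof (induction \<alpha>)
  case (Plus \<alpha> \<beta>)
  then show ?case by (auto simp: crisp_def one_eq_top)
qed (simp_all add: fl_char_eq_crisp fl_conc_crisp fl_star_crisp, simp add: crisp_def)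

lemma set_conc_lists: "V \<subseteq> lists Z \<Longrightarrow> W \<subseteq> lists Z \<Longrightarrow> set_conc V W \<subseteq> lists Z"
  by (auto simp: set_conc_def lists_eq_set subset_iff)

lemma set_pow_lists: "W \<subseteq> lists Z \<Longrightarrow> set_pow W n \<subseteq> lists Z"
  by (induction n) (simp_all add: set_conc_lists)

lemma frexp_words_lists:
  "letters \<alpha> \<subseteq> Z \<Longrightarrow> p ` scalars \<alpha> \<subseteq> Z \<Longrightarrow> frexp_words p \<alpha> \<subseteq> lists Z"
  by (induction \<alpha>) (simp_all add: set_conc_lists set_pow_lists image_Un UN_subset_iff)


section \<open>Attained joins of word weights\<close>

text \<open>Stronger than being a least upper bound: together the two conditions make
  \<open>s\<close> equal to the join of the weights of finitely many words of
  \<open>W\<close>.\<close>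

definition weight_join :: "('z \<Rightarrow> 'l::integral_l_monoid) \<Rightarrow> 'z list set \<Rightarrow> 'l \<Rightarrow> bool" where
  "weight_join c W s \<longleftrightarrow> (\<forall>w\<in>W. prod_list (map c w) \<le> s) \<and>
     (\<exists>F. finite F \<and> F \<subseteq> W \<and> s \<le> fsup (\<lambda>w. prod_list (map c w)) F)"

lemma weight_join_unique: "weight_join c W s \<Longrightarrow> weight_join c W t \<Longrightarrow> s = t"
  unfolding weight_join_def by (meson fsup_least order.antisym order.trans subsetD)

lemma weight_join_empty: "weight_join c {} \<bottom>"
  by (simp add: weight_join_def)

lemma weight_join_singleton: "weight_join c {w} (prod_list (map c w))"
  unfolding weight_join_def by (auto intro!: exI[of _ "{w}"] fsup_upper[of "{w}" w])

text \<open>The finite witnesses for the sets \<open>W i\<close> unite to a finite witness because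
  \<open>I\<close> is finite; an infinite union, as in the star, needs its own argument.\<close>

lemma weight_join_UN:
  assumes "finite I" and "\<And>i. i \<in> I \<Longrightarrow> weight_join c (W i) (s i)"
  shows "weight_join c (\<Union>i\<in>I. W i) (fsup s I)"
proof -
  obtain F where F: "\<And>i. i \<in> I \<Longrightarrow> finite (F i) \<and> F i \<subseteq> W i \<and>
      s i \<le> fsup (\<lambda>w. prod_list (map c w)) (F i)"
    using assms(2) unfolding weight_join_def by metis
  let ?F = "\<Union>i\<in>I. F i"
  have fin: "finite ?F" using assms(1) F by auto
  have "s i \<le> fsup (\<lambda>w. prod_list (map c w)) ?F" if "i \<in> I" for i
  proof -
    have "fsup (\<lambda>w. prod_list (map c w)) (F i) \<le> fsup (\<lambda>w. prod_list (map c w)) ?F"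
      using F that fin by (intro fsup_least fsup_upper) auto
    then show ?thesis using F[OF that] by auto
  qed
  then have "fsup s I \<le> fsup (\<lambda>w. prod_list (map c w)) ?F"
    using assms(1) by (rule_tac fsup_least)
  moreover have "prod_list (map c w) \<le> fsup s I" if "i \<in> I" "w \<in> W i" for i w
    using assms that fsup_upper[OF assms(1), of i s] unfolding weight_join_def
    by (meson order.trans)
  moreover have "?F \<subseteq> (\<Union>i\<in>I. W i)" using F by blast
  ultimately show ?thesis
    unfolding weight_join_def using fin by blast
qed

lemma weight_join_Un:
  assumes "weight_join c V s" and "weight_join c W t"
  shows "weight_join c (V \<union> W) (s \<squnion> t)"
proof -
  have "weight_join c (\<Union>b\<in>{True, False}. if b then V else W)
      (fsup (\<lambda>b. if b then s else t) {True, False})"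
    using assms by (intro weight_join_UN) auto
  then show ?thesis by (simp add: fsup_insert Un_commute sup_commute)
qed

text \<open>Here attainment pays off: products distribute over the finite joins of the two
  witnesses, and the concatenations of their words form the new witness.\<close>

lemma weight_join_conc:
  assumes "weight_join c V s" and "weight_join c W t"
  shows "weight_join c (set_conc V W) (s * t)"
proof -
  let ?h = "\<lambda>w. prod_list (map c w)"
  obtain F G where F: "finite F" "F \<subseteq> V" "s \<le> fsup ?h F" and G: "finite G" "G \<subseteq> W" "t \<le> fsup ?h G"
    using assms unfolding weight_join_def by blast
  have eq: "set_conc F G = (\<lambda>(v, w). v @ w) ` (F \<times> G)"
    by (auto simp: set_conc_def)
  have fin: "finite (set_conc F G)" unfolding eq using F G by simp
  have "s * t \<le> fsup ?h F * fsup ?h G"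
    using F G by (meson mult_mono_left mult_mono_right order.trans)
  also have "\<dots> \<le> fsup ?h (set_conc F G)"
  proof -
    have "?h v * ?h w \<le> fsup ?h (set_conc F G)" if "v \<in> F" "w \<in> G" for v w
      using fsup_upper[OF fin, of "v @ w" ?h] that by (auto simp: set_conc_def)
    then show ?thesis
      using F G by (simp add: fsup_mult_left fsup_mult_right fsup_le_iff)
  qed
  finally have "s * t \<le> fsup ?h (set_conc F G)" .
  moreover have "?h v * ?h w \<le> s * t" if "v \<in> V" "w \<in> W" for v w
    using assms that unfolding weight_join_def by (meson mult_mono_left mult_mono_right order.trans)
  then have "\<forall>w\<in>set_conc V W. ?h w \<le> s * t" by (auto simp: set_conc_def)
  moreover have "set_conc F G \<subseteq> set_conc V W" using F G by (auto simp: set_conc_def)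
  ultimately show ?thesis
    unfolding weight_join_def using fin by blast
qed

text \<open>A crisp factor keeps all words or discards them; so the transition and final values of a
  nondeterministic automaton become conditions on words.\<close>

lemma weight_join_crisp_factor:
  assumes "weight_join c W s" and "t \<in> {\<bottom>, 1}"
  shows "weight_join c (if t = 1 then W else {}) (s * t)"
  using assms by (cases "t = 1") (simp_all add: weight_join_empty)

text \<open>The invariant of the induction on expressions: \<open>f\<close> arises from
  \<open>W\<close> by erasing the letters outside \<open>X\<close> and joining the weights of the
  words with equal trace.\<close>

definition trace_join ::
    "'z set \<Rightarrow> ('z \<Rightarrow> 'l::integral_l_monoid) \<Rightarrow> 'z list set \<Rightarrow> ('z, 'l) flang \<Rightarrow> bool" where
  "trace_join X c W f \<longleftrightarrow> (\<forall>u. weight_join c {w \<in> W. filter (\<lambda>z. z \<in> X) w = u} (f u))"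

text \<open>Erasing letters commutes with concatenation, so the words with trace \<open>u\<close> in
  the product are sorted by the finitely many splittings of \<open>u\<close>.\<close>

lemma trace_join_conc:
  assumes "trace_join X c V f" and "trace_join X c W g"
  shows "trace_join X c (set_conc V W) (fl_conc f g)"
  unfolding trace_join_def
proof
  fix u
  let ?t = "filter (\<lambda>z. z \<in> X)"
  let ?W = "\<lambda>i. set_conc {v \<in> V. ?t v = fst i} {w \<in> W. ?t w = snd i}"
  have "weight_join c (\<Union>i\<in>{(v, w). u = v @ w}. ?W i) (fl_conc f g u)"
    unfolding fl_conc_def
  proof (rule weight_join_UN[OF finite_splits])
    fix i :: "'a list \<times> 'a list"
    show "weight_join c (?W i) (case i of (v, w) \<Rightarrow> f v * g w)"
      using assms unfolding trace_join_def by (cases i) (simp add: weight_join_conc)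
  qed
  moreover have "(\<Union>i\<in>{(v, w). u = v @ w}. ?W i) = {w \<in> set_conc V W. ?t w = u}"
    by (fastforce simp: set_conc_def)
  ultimately show "weight_join c {w \<in> set_conc V W. ?t w = u} (fl_conc f g u)" by simp
qed

text \<open>Covers the empty word, a letter of \<open>X\<close> of weight 1, and a letter of
  \<open>Y\<close>, whose trace is empty and whose weight is a scalar.\<close>

lemma trace_join_singleton:
  assumes "prod_list (map c w) = l"
  shows "trace_join X c {w} (\<lambda>u. l * fl_char (filter (\<lambda>z. z \<in> X) w) u)"
  unfolding trace_join_def
proof
  fix u
  have "{v \<in> {w}. filter (\<lambda>z. z \<in> X) v = u} = (if u = filter (\<lambda>z. z \<in> X) w then {w} else {})"
    by auto
  then show "weight_join c {v \<in> {w}. filter (\<lambda>z. z \<in> X) v = u}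
      (l * fl_char (filter (\<lambda>z. z \<in> X) w) u)"
    using weight_join_singleton[of c w] assms by (auto simp: fl_char_def weight_join_empty)
qed

lemma trace_join_Nil: "trace_join X c {[]} (fl_char [])"
  using trace_join_singleton[of c "[]" 1 X] by simp

lemma trace_join_pow: "trace_join X c W f \<Longrightarrow> trace_join X c (set_pow W n) (fl_pow f n)"
  by (induction n) (simp_all add: trace_join_Nil trace_join_conc)

text \<open>The value of the star at \<open>u\<close> is already the join of the powers up to the
  length of \<open>u\<close>, which yields a finite witness. All higher powers lie below the star,
  which yields the upper bound for words with more factors.\<close>

lemma trace_join_star:
  assumes "trace_join X c W f"
  shows "trace_join X c (\<Union>n. set_pow W n) (fl_star f)"
  unfolding trace_join_def
proof
  fix u
  let ?V = "\<lambda>n. {w \<in> set_pow W n. filter (\<lambda>z. z \<in> X) w = u}"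
  have pow: "weight_join c (?V n) (fl_pow f n u)" for n
    using trace_join_pow[OF assms] by (simp add: trace_join_def)
  have "weight_join c (\<Union>n\<in>{..length u}. ?V n) (fl_star f u)"
    unfolding fl_star_eq by (rule weight_join_UN) (use pow in auto)
  then obtain F where F: "finite F" "F \<subseteq> (\<Union>n\<in>{..length u}. ?V n)"
      "fl_star f u \<le> fsup (\<lambda>w. prod_list (map c w)) F"
    unfolding weight_join_def by blast
  have "prod_list (map c w) \<le> fl_star f u" if "w \<in> ?V n" for n w
    using pow[of n] that fl_star_lub[of f u "fl_star f u"] unfolding weight_join_def
    by (meson order.refl order.trans)
  then have "\<forall>w\<in>{w \<in> \<Union>n. set_pow W n. filter (\<lambda>z. z \<in> X) w = u}. prod_list (map c w) \<le> fl_star f u"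
    by blast
  moreover have "F \<subseteq> {w \<in> \<Union>n. set_pow W n. filter (\<lambda>z. z \<in> X) w = u}" using F by blast
  ultimately show "weight_join c {w \<in> \<Union>n. set_pow W n. filter (\<lambda>z. z \<in> X) w = u} (fl_star f u)"
    unfolding weight_join_def using F by blast
qed

text \<open>Presents scalar multiplication as a concatenation, matching the prefixed letter in
  \<open>frexp_R\<close>; only the splitting with empty first part contributes.\<close>

lemma fl_conc_scalar: "fl_conc (\<lambda>v. l * fl_char [] v) f u = l * f u"
proof (rule order.antisym)
  show "fl_conc (\<lambda>v. l * fl_char [] v) f u \<le> l * f u"
    by (auto simp: fl_conc_def fl_char_def fsup_le_iff finite_splits)
  show "l * f u \<le> fl_conc (\<lambda>v. l * fl_char [] v) f u"
    using fsup_upper[OF finite_splits[of u], of "([], u)" "\<lambda>(v, w). l * fl_char [] v * f w"]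
    by (simp add: fl_conc_def fl_char_def)
qed

lemma trace_join_frexp:
  assumes "\<And>x. x \<in> X \<Longrightarrow> c x = 1" and "letters \<alpha> \<subseteq> X"
    and "\<And>l. l \<in> scalars \<alpha> \<Longrightarrow> p l \<notin> X \<and> c (p l) = l"
  shows "trace_join X c (frexp_words p \<alpha>) (frexp_lang \<alpha>)"
  using assms(2,3)
proof (induction \<alpha>)
  case Empty
  then show ?case by (simp add: trace_join_def weight_join_empty)
next
  case Eps
  then show ?case by (simp add: trace_join_Nil)
next
  case (Letter x)
  then show ?case using trace_join_singleton[of c "[x]" 1 X] assms(1) by simp
next
  case (Scal l \<alpha>)
  have "trace_join X c {[p l]} (\<lambda>u. l * fl_char [] u)"
    using trace_join_singleton[of c "[p l]" l X] Scal.prems by simp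
  moreover have "trace_join X c (frexp_words p \<alpha>) (frexp_lang \<alpha>)"
    using Scal by simp
  ultimately have "trace_join X c (frexp_words p (Scal l \<alpha>))
      (fl_conc (\<lambda>u. l * fl_char [] u) (frexp_lang \<alpha>))"
    by (simp add: trace_join_conc)
  then show ?case by (simp add: fl_conc_scalar[abs_def])
next
  case (Plus \<alpha> \<beta>)
  then have "trace_join X c (frexp_words p \<alpha>) (frexp_lang \<alpha>)"
    "trace_join X c (frexp_words p \<beta>) (frexp_lang \<beta>)" by simp_all
  then show ?case
    by (auto simp: trace_join_def conj_disj_distribR Collect_disj_eq intro!: weight_join_Un)
next
  case (Conc \<alpha> \<beta>)
  then show ?case by (simp add: trace_join_conc)
next
  case (Star \<alpha>)
  then show ?case by (simp add: trace_join_star)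
qed


section \<open>Runs of a nondeterministic automaton\<close>

text \<open>Paths along transitions of value 1. The recursion is on the first letter, whereas
  \<open>delta_word\<close> recurs on the last; \<open>run_append\<close> mediates between the
  two.\<close>

primrec run :: "('s, 'z, 'l::integral_l_monoid) fuzzy_aut \<Rightarrow> 's \<Rightarrow> 'z list \<Rightarrow> 's \<Rightarrow> bool" where
  "run A a [] b \<longleftrightarrow> a = b"
| "run A a (z # w) b \<longleftrightarrow> (\<exists>c\<in>states A. delta A a z c = 1 \<and> run A c w b)"

text \<open>The assumption on \<open>a\<close> serves the case of empty \<open>v\<close>, where the
  intermediate state is \<open>a\<close> itself.\<close>

lemma run_append:
  assumes "a \<in> states A"
  shows "run A a (v @ w) b \<longleftrightarrow> (\<exists>c\<in>states A. run A a v c \<and> run A c w b)"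
  using assms by (induction v arbitrary: a) auto

text \<open>The alphabet is a parameter: \<open>Y\<close> gives the silent runs,
  \<open>X \<union> Y\<close> all runs.\<close>

definition runs ::
    "('s, 'z, 'l::integral_l_monoid) fuzzy_aut \<Rightarrow> 'z set \<Rightarrow> 's \<Rightarrow> 's \<Rightarrow> 'z list set" where
  "runs A Z a b = {w \<in> lists Z. run A a w b}"

lemma nondeterministic_delta:
  "nondeterministic A \<Longrightarrow> a \<in> states A \<Longrightarrow> x \<in> alphabet A \<Longrightarrow> b \<in> states A \<Longrightarrow>
    delta A a x b \<in> {\<bottom>, 1}"
  by (simp add: nondeterministic_def)

lemma delta_word_crisp:
  assumes "nondeterministic A" and "a \<in> states A"
  shows "b \<in> states A \<Longrightarrow> w \<in> lists (alphabet A) \<Longrightarrow>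
    delta_word A a w b = (if run A a w b then 1 else \<bottom>)"
proof (induction w arbitrary: b rule: rev_induct)
  case Nil
  then show ?case by (simp add: delta_word_Nil)
next
  case (snoc z w)
  have fin: "finite (states A)"
    using assms by (simp add: nondeterministic_def fuzzy_automaton_def)
  have "delta_word A a (w @ [z]) b
      = fsup (\<lambda>c. if run A a w c \<and> delta A c z b = 1 then 1 else \<bottom>) (states A)"
    unfolding delta_word_snoc
  proof (rule fsup_cong)
    fix c assume "c \<in> states A"
    moreover have "delta A c z b \<in> {\<bottom>, 1}"
      using snoc.prems \<open>c \<in> states A\<close> by (intro nondeterministic_delta[OF assms(1)]) auto
    ultimately show "delta_word A a w c * delta A c z b
        = (if run A a w c \<and> delta A c z b = 1 then 1 else \<bottom>)"
      using snoc by auto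
  qed
  then show ?case
    using fin assms(2) snoc.prems by (simp add: fsup_crisp run_append)
qed

text \<open>Words are not restricted to the alphabet here; the intersection with
  \<open>lists\<close> is taken where the set is used.\<close>

definition accepted :: "('s, 'z, 'l::integral_l_monoid) fuzzy_aut \<Rightarrow> 'z list set" where
  "accepted A = {w. \<exists>b\<in>states A. run A (init A) w b \<and> final A b = 1}"

lemma aut_lang_crisp:
  assumes "nondeterministic A" and "w \<in> lists (alphabet A)"
  shows "aut_lang A w = crisp (accepted A) w"
proof -
  have A: "finite (states A)" "init A \<in> states A"
    using assms by (auto simp: nondeterministic_def fuzzy_automaton_def)
  have "aut_lang A w = fsup (\<lambda>b. if run A (init A) w b \<and> final A b = 1 then 1 else \<bottom>) (states A)"
    unfolding aut_lang_def
  proof (rule fsup_cong)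
    fix b assume "b \<in> states A"
    moreover from this have "final A b \<in> {\<bottom>, 1}"
      using assms(1) by (simp add: nondeterministic_def)
    ultimately show "delta_word A (init A) w b * final A b
        = (if run A (init A) w b \<and> final A b = 1 then 1 else \<bottom>)"
      using delta_word_crisp[OF assms(1) A(2) _ assms(2)] by auto
  qed
  then show ?thesis using A(1) by (simp add: fsup_crisp crisp_def accepted_def)
qed


section \<open>The relation of silent moves\<close>

text \<open>The Floyd--Warshall recursion computes a transitive relation above \<open>R\<close> from finitely many
  joins and products; loops need not be iterated since \<open>1\<close> is the greatest element.\<close>

lemma transitive_extension_induct:
  fixes R :: "'s \<Rightarrow> 's \<Rightarrow> 'l::integral_l_monoid"
  assumes "finite A" and "fuzzy_rel_on A R"
    and base: "\<And>a b. a \<in> A \<Longrightarrow> b \<in> A \<Longrightarrow> Q a b (R a b)"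
    and sup: "\<And>a b s t. a \<in> A \<Longrightarrow> b \<in> A \<Longrightarrow> Q a b s \<Longrightarrow> Q a b t \<Longrightarrow> Q a b (s \<squnion> t)"
    and mult: "\<And>a b c s t. a \<in> A \<Longrightarrow> b \<in> A \<Longrightarrow> c \<in> A \<Longrightarrow> Q a b s \<Longrightarrow> Q b c t \<Longrightarrow> Q a c (s * t)"
  obtains S where "fuzzy_rel_on A S" "transitive_on A S" "R \<le> S"
    "\<And>a b. a \<in> A \<Longrightarrow> b \<in> A \<Longrightarrow> Q a b (S a b)"
proof -
  \<comment> \<open>Invariant for the set \<open>B\<close> of pivots handled so far:
    \<open>S\<close> absorbs every composition through a state of \<open>B\<close>. For
    \<open>B = A\<close> this gives transitivity.\<close>
  have "\<exists>S. fuzzy_rel_on A S \<and> R \<le> S \<and> (\<forall>a\<in>A. \<forall>b\<in>A. Q a b (S a b)) \<and>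
      (\<forall>c\<in>B. \<forall>a b. S a c * S c b \<le> S a b)" if "finite B" "B \<subseteq> A" for B
    using that
  proof (induction B rule: finite_induct)
    case empty
    then show ?case using assms by blast
  next
    case (insert d B)
    then obtain S where S: "fuzzy_rel_on A S" "R \<le> S" "\<And>a b. a \<in> A \<Longrightarrow> b \<in> A \<Longrightarrow> Q a b (S a b)"
      and tr: "\<And>a b c. c \<in> B \<Longrightarrow> S a c * S c b \<le> S a b" by blast
    define T where "T a b = S a b \<squnion> S a d * S d b" for a b
    have d: "d \<in> A" using insert.prems by simp
    have "fuzzy_rel_on A T" using S(1) by (auto simp: fuzzy_rel_on_def T_def)
    moreover have "R \<le> T" using S(2) by (auto simp: le_fun_def T_def intro: le_supI1)
    moreover have "Q a b (T a b)" if "a \<in> A" "b \<in> A" for a b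
      unfolding T_def using S(3) that d by (blast intro: sup mult)
    moreover have "T a c * T c b \<le> T a b" if c: "c \<in> insert d B" for a b c
    proof -
      \<comment> \<open>A path meeting the pivot \<open>d\<close> twice weighs at most as much as
        the path with the loop cut out.\<close>
      have 1: "S a d * x * (y * S d b) \<le> S a d * S d b" for x y
        by (meson mult_le_left mult_le_right mult_mono_left mult_mono_right order.trans)
      show ?thesis
      proof (cases "c = d")
        case True
        \<comment> \<open>The additional term of \<open>T\<close> contains the factor
          \<open>S d d\<close>, which can only make it smaller.\<close>
        have "T a d = S a d" "T d b = S d b"
          unfolding T_def by (simp_all add: sup.absorb1 mult_le_left mult_le_right)
        then show ?thesis using True by (simp add: T_def)
      next
        case False
        then have cB: "c \<in> B" using c by simp
        have 2: "S a c * (S c d * S d b) \<le> S a d * S d b"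
          using mult_mono_right[OF tr[OF cB, of a d]] by (simp add: mult.assoc)
        have 3: "S a d * S d c * S c b \<le> S a d * S d b"
          using mult_mono_left[OF tr[OF cB, of d b]] by (simp add: mult.assoc)
        show ?thesis
          unfolding T_def mult_sup_distrib_left mult_sup_distrib_right
          using tr[OF cB, of a b] 1[of "S d c" "S c d"] 2 3
          by (auto intro: le_supI1 le_supI2)
      qed
    qed
    ultimately show ?case by (intro exI[of _ T] conjI ballI allI) simp_all
  qed
  from this[OF assms(1) order.refl] obtain S where "fuzzy_rel_on A S" "R \<le> S"
    "\<And>a b. a \<in> A \<Longrightarrow> b \<in> A \<Longrightarrow> Q a b (S a b)"
    "\<And>a b c. c \<in> A \<Longrightarrow> S a c * S c b \<le> S a b"
    by blast
  then show ?thesis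
    using that[of S] by (simp add: transitive_on_def)
qed

text \<open>The upper bound follows a run letter by letter, using that \<open>R_A\<close> contains
  \<open>R\<close> and is transitive. For attainment, the Floyd-Warshall recursion supplies some
  transitive \<open>S\<close> above \<open>R\<close> with finite witnesses; leastness puts
  \<open>R_A\<close> below \<open>S\<close>, so these witnesses serve \<open>R_A\<close> as
  well.\<close>

lemma weight_join_rel_RA:
  fixes A :: "('s, 'z, 'l::integral_l_monoid) fuzzy_aut"
  assumes A: "nondeterministic A" and "finite K" and "p ` K \<subseteq> alphabet A"
    and c: "\<And>l. l \<in> K \<Longrightarrow> c (p l) = l"
    and ab: "a \<in> states A" "b \<in> states A"
  shows "weight_join c (runs A (p ` K) a b) (rel_RA A K p a b)"
proof -
  let ?R = "rel_RA A K p" and ?W = "runs A (p ` K)"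
  have FA: "fuzzy_automaton A" and fin: "finite (states A)"
    using A by (auto simp: nondeterministic_def fuzzy_automaton_def)
  note least = rel_RA_least[OF FA, where K = K and p = p]
  have step: "rel_R A K p a b \<le> ?R a b" for a b
    using least(3) by (simp add: le_fun_def)
  have upper: "prod_list (map c w) \<le> ?R a b"
    if "w \<in> lists (p ` K)" "run A a w b" "a \<in> states A" for w a
    using that
  proof (induction w arbitrary: a)
    case Nil
    then show ?case using step[of a a] by (simp add: rel_R_def)
  next
    case (Cons z w)
    then obtain d l where d: "d \<in> states A" "delta A a z d = 1" "run A d w b" and l: "l \<in> K" "z = p l"
      by auto
    \<comment> \<open>On the diagonal \<open>R\<close> is 1, the greatest element, so a silent loop
      is bounded as well.\<close>
    have "l \<le> rel_R A K p a d"
    proof (cases "a = d")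
      case False
      then show ?thesis
        using fsup_upper[OF assms(2) l(1), of "\<lambda>l. l * delta A a (p l) d"] d l Cons.prems
        by (simp add: rel_R_def)
    qed (use d in \<open>simp add: rel_R_def\<close>)
    then have "c z \<le> ?R a d" using step[of a d] l c by (metis order.trans)
    moreover have "prod_list (map c w) \<le> ?R d b" using Cons d by simp
    ultimately have "c z * prod_list (map c w) \<le> ?R a d * ?R d b"
      by (meson mult_mono_left mult_mono_right order.trans)
    also have "\<dots> \<le> ?R a b"
      using least(2) d Cons.prems ab(2) unfolding transitive_on_def by blast
    finally show ?case by simp
  qed
  \<comment> \<open>A subset suffices, since the recursion leaves out runs, for instance those with
    loops; only the finite witness is taken from it.\<close>
  define Q where "Q a b s \<longleftrightarrow> (\<exists>W \<subseteq> ?W a b. weight_join c W s)" for a b s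
  have QI: "Q a b s" if "weight_join c W s" "W \<subseteq> ?W a b" for a b s W
    using that by (auto simp: Q_def)
  obtain S where S: "fuzzy_rel_on (states A) S" "transitive_on (states A) S" "rel_R A K p \<le> S"
    "\<And>a b. a \<in> states A \<Longrightarrow> b \<in> states A \<Longrightarrow> Q a b (S a b)"
  proof (rule transitive_extension_induct[of "states A" "rel_R A K p" Q])
    show "fuzzy_rel_on (states A) (rel_R A K p)"
      by (simp add: fuzzy_rel_on_def rel_R_def)
    fix a b assume ab: "a \<in> states A" "b \<in> states A"
    show "Q a b (rel_R A K p a b)"
    proof (cases "a = b")
      case True
      \<comment> \<open>The diagonal value 1 is the weight of the empty word, a run from
        \<open>a\<close> to itself.\<close>
      then show ?thesis
        using ab weight_join_singleton[of c "[]"]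
        by (auto simp: Q_def rel_R_def runs_def intro!: exI[of _ "{[]}"])
    next
      case False
      have "weight_join c (if delta A a (p l) b = 1 then {[p l]} else {}) (l * delta A a (p l) b)"
        if l: "l \<in> K" for l
      proof -
        have "delta A a (p l) b \<in> {\<bottom>, 1}"
          using ab l assms(3) by (intro nondeterministic_delta[OF A]) auto
        from weight_join_crisp_factor[OF weight_join_singleton[of c "[p l]"] this]
        show ?thesis using c[OF l] by simp
      qed
      then have "weight_join c (\<Union>l\<in>K. if delta A a (p l) b = 1 then {[p l]} else {})
          (fsup (\<lambda>l. l * delta A a (p l) b) K)"
        by (rule weight_join_UN[OF assms(2)])
      moreover have "(\<Union>l\<in>K. if delta A a (p l) b = 1 then {[p l]} else {}) \<subseteq> ?W a b"
        using ab by (auto simp: runs_def split: if_splits)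
      moreover have "rel_R A K p a b = fsup (\<lambda>l. l * delta A a (p l) b) K"
        using False ab by (simp add: rel_R_def)
      ultimately show ?thesis by (simp only: QI)
    qed
  next
    fix a b s t assume "Q a b s" "Q a b t"
    then obtain V W where "weight_join c V s" "V \<subseteq> ?W a b" "weight_join c W t" "W \<subseteq> ?W a b"
      unfolding Q_def by blast
    then show "Q a b (s \<squnion> t)" using QI[OF weight_join_Un] by blast
  next
    fix a b d s t assume ab: "a \<in> states A" "b \<in> states A" and "Q a b s" "Q b d t"
    then obtain V W where VW: "weight_join c V s" "V \<subseteq> ?W a b" "weight_join c W t" "W \<subseteq> ?W b d"
      unfolding Q_def by blast
    have "set_conc V W \<subseteq> ?W a d"
    proof
      fix u assume "u \<in> set_conc V W"
      then obtain v w where "u = v @ w" "v \<in> ?W a b" "w \<in> ?W b d"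
        using VW by (auto simp: set_conc_def)
      then show "u \<in> ?W a d" using ab by (auto simp: runs_def run_append)
    qed
    then show "Q a d (s * t)" using QI[OF weight_join_conc] VW by blast
  qed (use fin in auto)
  have "?R a b \<le> S a b" using least(4)[OF S(1-3)] by (simp add: le_fun_def)
  then have "\<exists>F. finite F \<and> F \<subseteq> ?W a b \<and> ?R a b \<le> fsup (\<lambda>w. prod_list (map c w)) F"
    using S(4)[OF ab] unfolding Q_def weight_join_def by (meson order.trans)
  then show ?thesis
    unfolding weight_join_def using upper ab by (auto simp: runs_def)
qed


section \<open>The reduced automaton\<close>

text \<open>The mirror image of \<open>filter_eq_ConsD\<close>: the word is cut at its last kept
  letter.\<close>

lemma filter_eq_snocD:
  assumes "filter P w = u @ [x]"
  obtains v v' where "w = v @ x # v'" "filter P v = u" "P x" "\<forall>z\<in>set v'. \<not> P z"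
proof -
  have "filter P (rev w) = x # rev u" using assms by (simp add: rev_filter[symmetric])
  from filter_eq_ConsD[OF this] obtain us vs where uv: "rev w = us @ x # vs"
    "\<forall>z\<in>set us. \<not> P z" "P x" "rev u = filter P vs" by blast
  have "w = rev vs @ x # rev us" using arg_cong[OF uv(1), of rev] by simp
  moreover have "filter P (rev vs) = u" by (simp add: rev_filter[symmetric] uv(4)[symmetric])
  ultimately show ?thesis using that[of "rev vs" "rev us"] uv(2,3) by simp
qed

text \<open>Composing with \<open>R_A\<close> at the end accounts for silent letters after the last
  letter of \<open>X\<close>. A word with trace \<open>u\<close> thus splits into silent blocks,
  each matched by a factor \<open>R_A\<close>, separated by the letters of \<open>u\<close>.\<close>

lemma weight_join_reduced:
  fixes A :: "('s, 'z, 'l::integral_l_monoid) fuzzy_aut" and \<alpha> :: "('l, 'z) frexp"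
    and X :: "'z set" and p :: "'l \<Rightarrow> 'z"
  defines "B \<equiv> reduced_automaton A X \<alpha> p" and "Y \<equiv> p ` scalars \<alpha>"
  assumes A: "nondeterministic A" and alph: "alphabet A = X \<union> Y" and disj: "Y \<inter> X = {}"
    and cX: "\<And>x. x \<in> X \<Longrightarrow> c x = 1" and cY: "\<And>l. l \<in> scalars \<alpha> \<Longrightarrow> c (p l) = l"
  shows "u \<in> lists X \<Longrightarrow> d \<in> states A \<Longrightarrow>
    weight_join c {w \<in> runs A (X \<union> Y) (init A) d. filter (\<lambda>z. z \<in> X) w = u}
      (fsup (\<lambda>b. delta_word B (init A) u b * rel_RA A (scalars \<alpha>) p b d) (states B))"
proof -
  let ?R = "rel_RA A (scalars \<alpha>) p" and ?W = "\<lambda>u d. {w \<in> runs A (X \<union> Y) (init A) d.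
    filter (\<lambda>z. z \<in> X) w = u}"
  have finA: "finite (states A)" and init: "init A \<in> states A"
    using A by (auto simp: nondeterministic_def fuzzy_automaton_def)
  have BA: "states B \<subseteq> states A" using init by (auto simp: B_def reduced_automaton_def)
  then have finB: "finite (states B)" using finA finite_subset by blast
  have silent: "weight_join c (runs A Y b d) (?R b d)" if "b \<in> states A" "d \<in> states A" for b d
    unfolding Y_def
    using weight_join_rel_RA[OF A finite_scalars[of \<alpha>], of p c b d] alph cY that
    by (simp add: Y_def)
  show "u \<in> lists X \<Longrightarrow> d \<in> states A \<Longrightarrow> weight_join c (?W u d)
      (fsup (\<lambda>b. delta_word B (init A) u b * ?R b d) (states B))"
  proof (induction u arbitrary: d rule: rev_induct)
    case Nil
    have "fsup (\<lambda>b. delta_word B (init A) [] b * ?R b d) (states B) = ?R (init A) d"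
    proof (rule order.antisym)
      show "fsup (\<lambda>b. delta_word B (init A) [] b * ?R b d) (states B) \<le> ?R (init A) d"
        using finB by (simp add: fsup_le_iff delta_word_Nil)
      have "init A \<in> states B" by (simp add: B_def reduced_automaton_def)
      then show "?R (init A) d \<le> fsup (\<lambda>b. delta_word B (init A) [] b * ?R b d) (states B)"
        using fsup_upper[OF finB, of "init A" "\<lambda>b. delta_word B (init A) [] b * ?R b d"]
        by (simp add: delta_word_Nil)
    qed
    moreover have "?W [] d = runs A Y (init A) d"
      using disj by (auto simp: runs_def filter_empty_conv)
    ultimately show ?case using silent[OF init Nil.prems(2)] by simp
  next
    case (snoc x u)
    let ?D = "delta_word B (init A)" and ?E = "\<lambda>e. fsup (\<lambda>b. delta_word B (init A) u b * ?R b e) (states B)"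
    have x: "x \<in> X" and u: "u \<in> lists X" using snoc.prems by auto
    \<comment> \<open>Associativity moves \<open>R_A\<close> from the front of the
      \<open>x\<close>-transition to the end of the value at \<open>u\<close>, producing the
      quantity of the induction hypothesis.\<close>
    have D: "?D (u @ [x]) b = fsup (\<lambda>e. ?E e * delta A e x b) (states A)" for b
    proof -
      have "delta B = (\<lambda>a x b. fsup (\<lambda>e. ?R a e * delta A e x b) (states A))"
        by (simp add: B_def reduced_automaton_def rel_comp_def)
      then show ?thesis
        using fsup_matrix_assoc[OF finB finA, of "?D u" ?R "\<lambda>e. delta A e x b"]
        by (simp add: delta_word_snoc)
    qed
    \<comment> \<open>The words that reach \<open>b\<close> with trace \<open>u @ [x]\<close> and
      end in the letter \<open>x\<close>, with no silent letters after it.\<close>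
    let ?V = "\<lambda>b. \<Union>e\<in>states A. if delta A e x b = 1 then set_conc (?W u e) {[x]} else {}"
    have "weight_join c (?V b) (?D (u @ [x]) b)" if b: "b \<in> states B" for b
      unfolding D
    proof (rule weight_join_UN[OF finA])
      fix e assume e: "e \<in> states A"
      have "weight_join c (set_conc (?W u e) {[x]}) (?E e)"
        using weight_join_conc[OF snoc.IH[OF u e] weight_join_singleton[of c "[x]"]] cX[OF x] by simp
      moreover have "delta A e x b \<in> {\<bottom>, 1}"
        using e b BA x alph by (intro nondeterministic_delta[OF A]) auto
      ultimately show "weight_join c (if delta A e x b = 1 then set_conc (?W u e) {[x]} else {})
          (?E e * delta A e x b)"
        by (rule weight_join_crisp_factor)
    qed
    then have "weight_join c (\<Union>b\<in>states B. set_conc (?V b) (runs A Y b d))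
        (fsup (\<lambda>b. ?D (u @ [x]) b * ?R b d) (states B))"
      using BA snoc.prems by (intro weight_join_UN finB weight_join_conc silent) auto
    moreover have "(\<Union>b\<in>states B. set_conc (?V b) (runs A Y b d)) = ?W (u @ [x]) d"
    proof (intro equalityI subsetI)
      fix w assume "w \<in> (\<Union>b\<in>states B. set_conc (?V b) (runs A Y b d))"
      then obtain b e v v' where be: "b \<in> states B" "e \<in> states A" "delta A e x b = 1"
        and v: "v \<in> ?W u e" "v' \<in> runs A Y b d" and w: "w = (v @ [x]) @ v'"
        by (fastforce simp: set_conc_def split: if_splits)
      have "filter (\<lambda>z. z \<in> X) v' = []"
        using v(2) disj by (auto simp: runs_def filter_empty_conv)
      then show "w \<in> ?W (u @ [x]) d"
        using be v x BA init unfolding w by (auto simp: runs_def run_append)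
    next
      fix w assume w: "w \<in> ?W (u @ [x]) d"
      then have "filter (\<lambda>z. z \<in> X) w = u @ [x]" by simp
      then obtain v v' where vv: "w = v @ x # v'" "filter (\<lambda>z. z \<in> X) v = u" "\<forall>z\<in>set v'. z \<notin> X"
        by (rule filter_eq_snocD)
      have "run A (init A) (v @ x # v') d" using w vv(1) by (simp add: runs_def)
      then obtain e b where be: "e \<in> states A" "b \<in> states A" "delta A e x b = 1"
        "run A (init A) v e" "run A b v' d"
        using init by (auto simp: run_append)
      \<comment> \<open>The cut at the last letter of \<open>X\<close> makes \<open>b\<close> the
        target of an \<open>x\<close>-transition, hence a state of the reduced automaton.\<close>
      have "b \<in> states B" using be x by (auto simp: B_def reduced_automaton_def)
      moreover have "v @ [x] \<in> ?V b"
        using be vv w by (auto simp: set_conc_def runs_def intro!: bexI[of _ e])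
      moreover have "v' \<in> runs A Y b d" using be vv w by (auto simp: runs_def)
      moreover have "w = (v @ [x]) @ v'" using vv by simp
      ultimately show "w \<in> (\<Union>b\<in>states B. set_conc (?V b) (runs A Y b d))"
        unfolding set_conc_def[of "?V _"] by blast
    qed
    ultimately show ?case by simp
  qed
qed

theorem theorem5p1:
  fixes X Y :: "'z set"
    and \<alpha> :: "('l::integral_l_monoid, 'z) frexp"
    and p :: "'l \<Rightarrow> 'z"
    and A :: "('s, 'z, 'l) fuzzy_aut"
  assumes "finite X"
    and "letters \<alpha> \<subseteq> X"
    and "associated_alphabet X \<alpha> Y p"
    and "nondeterministic A"
    and "alphabet A = X \<union> Y"
    and "\<forall>w\<in>lists (X \<union> Y). aut_lang A w = frexp_lang (frexp_R p \<alpha>) w"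
  shows "\<forall>u\<in>lists X. aut_lang (reduced_automaton A X \<alpha> p) u = frexp_lang \<alpha> u"
\<comment> \<open>If \<open>\<bottom> = 1\<close> the monoid has a single element and the claim is
  trivial; otherwise a crisp language determines its set of words.\<close>
proof (cases "\<bottom> = (1::'l)")
  case True
  have "x = y" for x y :: 'l
    by (rule order.antisym) (metis True bot.extremum le_one order.trans)+
  then show ?thesis by blast
next
  case nontrivial: False
  let ?B = "reduced_automaton A X \<alpha> p" and ?R = "rel_RA A (scalars \<alpha>) p"
  have Y: "Y = p ` scalars \<alpha>" and disj: "Y \<inter> X = {}" and inj: "inj_on p (scalars \<alpha>)"
    using assms(3) by (auto simp: associated_alphabet_def bij_betw_def)
  \<comment> \<open>The weight of a letter: 1 on \<open>X\<close>, and on \<open>Y\<close> the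
    scalar it stands for, recovered by inverting the bijection \<open>p\<close>.\<close>
  define c where "c z = (if z \<in> X then 1 else inv_into (scalars \<alpha>) p z)" for z
  have cX: "c x = 1" if "x \<in> X" for x using that by (simp add: c_def)
  have cY: "p l \<notin> X \<and> c (p l) = l" if "l \<in> scalars \<alpha>" for l
    using that disj inj by (auto simp: c_def Y)
  have finA: "finite (states A)" and init: "init A \<in> states A"
    using assms(4) by (auto simp: nondeterministic_def fuzzy_automaton_def)
  have "states ?B \<subseteq> states A" using init by (auto simp: reduced_automaton_def)
  then have finB: "finite (states ?B)" using finA finite_subset by blast
  have "frexp_words p \<alpha> \<subseteq> lists (X \<union> Y)"
    using assms(2) by (intro frexp_words_lists) (auto simp: Y)
  moreover have "w \<in> accepted A \<longleftrightarrow> w \<in> frexp_words p \<alpha>" if "w \<in> lists (X \<union> Y)" for w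
  proof -
    have "crisp (accepted A) w = (crisp (frexp_words p \<alpha>) w :: 'l)"
      using assms(4-6) that by (metis aut_lang_crisp frexp_lang_R)
    then show ?thesis using nontrivial by (auto simp: crisp_def split: if_splits)
  qed
  ultimately have words: "frexp_words p \<alpha> = accepted A \<inter> lists (X \<union> Y)" by blast
  show ?thesis
  proof
    fix u assume u: "u \<in> lists X"
    let ?t = "filter (\<lambda>z. z \<in> X)"
    let ?E = "\<lambda>d. fsup (\<lambda>b. delta_word ?B (init A) u b * ?R b d) (states ?B)"
    let ?V = "\<lambda>d. {w \<in> runs A (X \<union> Y) (init A) d. ?t w = u}"
    \<comment> \<open>The factor \<open>R_A\<close> is taken from the final vector and joined to the
      transition values, which gives the expression treated in
      \<open>weight_join_reduced\<close>.\<close>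
    have E: "aut_lang ?B u = fsup (\<lambda>d. ?E d * final A d) (states A)"
    proof -
      have "init ?B = init A" "final ?B = (\<lambda>b. fsup (\<lambda>d. ?R b d * final A d) (states A))"
        by (simp_all add: reduced_automaton_def rel_comp_set_def)
      then show ?thesis
        using fsup_matrix_assoc[OF finB finA, of "delta_word ?B (init A) u" ?R "final A"]
        by (simp add: aut_lang_def)
    qed
    have "weight_join c (\<Union>d\<in>states A. if final A d = 1 then ?V d else {}) (aut_lang ?B u)"
      unfolding E
    proof (rule weight_join_UN[OF finA])
      fix d assume d: "d \<in> states A"
      have "weight_join c (?V d) (?E d)"
        unfolding Y
        by (rule weight_join_reduced[OF assms(4)])
          (use assms(5) disj cX cY u d in \<open>auto simp: Y\<close>)
      moreover have "final A d \<in> {\<bottom>, 1}" using assms(4) d by (simp add: nondeterministic_def)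
      ultimately show "weight_join c (if final A d = 1 then ?V d else {}) (?E d * final A d)"
        by (rule weight_join_crisp_factor)
    qed
    moreover have "(\<Union>d\<in>states A. if final A d = 1 then ?V d else {})
        = {w \<in> frexp_words p \<alpha>. ?t w = u}"
      unfolding words by (auto simp: accepted_def runs_def split: if_splits)
    moreover have "weight_join c {w \<in> frexp_words p \<alpha>. ?t w = u} (frexp_lang \<alpha> u)"
      using trace_join_frexp[of X c \<alpha> p] cX cY assms(2) by (auto simp: trace_join_def)
    ultimately show "aut_lang ?B u = frexp_lang \<alpha> u"
      by (simp only: weight_join_unique)
  qed
qed

end
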